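(* Let $p\geq 2$ be a large prime, and let $s\geq 2$ be a small integer. Then the finite field $\mathbb{F}_p$ contains $s$-power free primitive roots. Furthermore, the number $N_s(p)$ of such elements satisfies $$N_s(p)=\frac{1}{\zeta(s)}\,\frac{\varphi(p-1)}{p-1}\,p+O\left(p^{1-\varepsilon}\right),$$ where $\zeta(s)$ is the Riemann zeta function and $\varepsilon>0$ is an arbitrarily small number.
   Context: An element $\alpha\in\mathbb{F}_p$ is a primitive root if its multiplicative order $\mathrm{ord}_p(\alpha)$ equals $p-1$. Elements $n\in\mathbb{F}_p$ are identified with their integer representatives $0\leq n\leq p-1$. An integer $n$ is $s$-power free if $r^s\nmid n$ for every prime $r\geq 2$; $\mu_s$ denotes the characteristic function of $s$-power free integers. Then $$N_s(p)=\#\{n\in\mathbb{F}_p:\ \mathrm{ord}_p(n)=p-1 \text{ and } \mu_s(n)=1\}.$$ $\varphi$ is Euler's totient function. "Large prime" means $p$ sufficiently large, "small integer" means $s$ is fixed, and asymptotics are for $p\to\infty$. *)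

theory Defs
  imports "HOL-Number_Theory.Number_Theory" "HOL-Library.Landau_Symbols"
begin

text \<open>Elements of \<open>\<bbbF>\<^sub>p\<close> are represented by the natural numbers \<open>n < p\<close>; their multiplicative
  order is the library's \<^const>\<open>ord\<close>, which is \<open>0\<close> for \<open>n = 0\<close>.\<close>

definition primitive_root_mod :: "nat \<Rightarrow> nat \<Rightarrow> bool" where
  "primitive_root_mod p n \<longleftrightarrow> ord p n = p - 1"

text \<open>The integer \<open>0\<close> is not \<open>s\<close>-power free for any \<open>s\<close>.\<close>

definition power_free :: "nat \<Rightarrow> nat \<Rightarrow> bool" where
  "power_free s n \<longleftrightarrow> (\<forall>r. prime r \<longrightarrow> \<not> r ^ s dvd n)"

definition mu_power_free :: "nat \<Rightarrow> nat \<Rightarrow> nat" where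
  "mu_power_free s n = (if power_free s n then 1 else 0)"

definition N_power_free :: "nat \<Rightarrow> nat \<Rightarrow> nat" where
  "N_power_free s p = card {n \<in> {0..<p}. primitive_root_mod p n \<and> mu_power_free s n = 1}"

text \<open>The Riemann zeta function on the real half-line \<open>s > 1\<close>, where its Dirichlet series
  converges; for \<open>s \<le> 1\<close> the value is meaningless.\<close>

definition riemann_zeta :: "real \<Rightarrow> real" where
  "riemann_zeta s = (\<Sum>n. 1 / real (Suc n) powr s)"

text \<open>The filter for \<open>p \<rightarrow> \<infinity>\<close> along the primes.\<close>

definition primes_at_top :: "nat filter" where
  "primes_at_top = inf at_top (principal {p. prime p})"

end

theory Submission
  imports Defs "HOL-Library.Real_Mod" "HOL-Computational_Algebra.Squarefree"
    "HOL-Analysis.Harmonic_Numbers" "HOL-Analysis.Infinite_Sum" "HOL-Real_Asymp.Real_Asymp"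
begin

text \<open>With \<open>\<mu>\<close> the Moebius function, \<open>\<mu>\<^sub>s(n)\<close> is the sum of \<open>\<mu>(d)\<close> over \<open>d\<^sup>s dvd n\<close>, so \<open>N\<^sub>s(p)\<close> is
  the sum over \<open>d\<close> of \<open>\<mu>(d)\<close> times the number \<open>A(d)\<close> of primitive roots below \<open>p\<close> divisible by \<open>d\<^sup>s\<close>.
  For \<open>d\<close> up to about \<open>p\<close> to the power \<open>1/4\<close>, \<open>A(d)\<close> is found with additive characters modulo \<open>p\<close>:
  by inclusion-exclusion over the primes dividing \<open>p - 1\<close>, the indicator of the primitive roots is
  a signed sum of \<open>2\<^sup>\<omega>\<close> indicators of subgroups, each of which has nontrivial Fourier coefficients
  at most \<open>sqrt p\<close>, and completing the sum over multiples costs a factor \<open>ln p\<close> as in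
  Polya--Vinogradov. For larger \<open>d\<close> the trivial bound \<open>A(d) \<le> p / d\<^sup>s\<close> suffices. As \<open>2\<^sup>\<omega>\<close> is smaller
  than any power of \<open>p\<close>, the total error is \<open>p\<close> to the power \<open>7/8\<close>, while \<open>\<phi>(p - 1) / (p - 1) \<ge> 1 / 2\<^sup>\<omega>\<close>
  makes the main term dominate it.\<close>

subsection \<open>Additive characters\<close>

text \<open>The character \<open>k \<mapsto> e(k / p)\<close>, taken on all integers rather than on
  residues so that differences and negated frequencies need no reduction modulo
  \<open>p\<close>.\<close>

definition add_char :: "nat \<Rightarrow> int \<Rightarrow> complex" where
  "add_char p k = cis (2 * pi * of_int k / of_nat p)"

lemma add_char_0 [simp]: "add_char p 0 = 1"
  by (simp add: add_char_def)

lemma norm_add_char [simp]: "norm (add_char p k) = 1"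
  by (simp add: add_char_def)

lemma add_char_add: "add_char p (k + l) = add_char p k * add_char p l"
  by (simp add: add_char_def cis_mult add_divide_distrib distrib_left)

lemma cnj_add_char: "cnj (add_char p k) = add_char p (- k)"
  by (simp add: add_char_def cis_cnj)

lemma add_char_power: "add_char p k ^ n = add_char p (int n * k)"
  unfolding add_char_def Complex.DeMoivre by (simp add: mult_ac)

lemma add_char_eq_1_iff:
  assumes "p > 0"
  shows "add_char p k = 1 \<longleftrightarrow> int p dvd k"
proof
  assume "add_char p k = 1"
  then obtain n :: int where "2 * pi * of_int k / of_nat p = of_int n * (2 * pi)"
    unfolding add_char_def cis_eq_1_iff by blast
  hence "(of_int k :: real) = of_int (n * int p)"
    using assms by (simp add: field_simps)
  hence "k = n * int p" by linarith
  thus "int p dvd k" by simp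
next
  assume "int p dvd k"
  then obtain n where "k = int p * n" ..
  thus "add_char p k = 1"
    using assms unfolding add_char_def cis_eq_1_iff by (intro exI[of _ n]) simp
qed

lemma add_char_cong:
  assumes "p > 0" "[k = l] (mod int p)"
  shows "add_char p k = add_char p l"
proof -
  have "add_char p (k - l) = 1"
    using assms by (simp add: add_char_eq_1_iff cong_iff_dvd_diff)
  thus ?thesis
    using add_char_add[of p "k - l" l] by simp
qed

text \<open>Orthogonality: unless \<open>p\<close> divides \<open>k\<close>, this is a full
  geometric series whose ratio is a nontrivial \<open>p\<close>-th root of unity.\<close>

lemma sum_add_char:
  assumes "p > 0"
  shows "(\<Sum>t<p. add_char p (int t * k)) = (if int p dvd k then of_nat p else 0)"
proof (cases "int p dvd k")
  case True
  hence "add_char p (int t * k) = 1" for t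
    using assms by (simp add: add_char_eq_1_iff)
  thus ?thesis using True by simp
next
  case False
  have "(\<Sum>t<p. add_char p (int t * k)) = (\<Sum>t<p. add_char p k ^ t)"
    by (simp add: add_char_power)
  also have "\<dots> = (add_char p k ^ p - 1) / (add_char p k - 1)"
    using False assms by (intro geometric_sum) (simp add: add_char_eq_1_iff)
  also have "add_char p k ^ p = 1"
    using assms by (simp add: add_char_power add_char_eq_1_iff)
  finally show ?thesis using False by simp
qed

text \<open>Opening the square gives a double sum over \<open>h\<close> and \<open>h'\<close>.
  Orthogonality keeps only its diagonal, because distinct elements of \<open>H\<close> are
  incongruent modulo \<open>p\<close>.\<close>

lemma parseval_add_char:
  assumes "p > 0" "H \<subseteq> {..<p}"
  shows "(\<Sum>u<p. (norm (\<Sum>h\<in>H. add_char p (int u * int h)))\<^sup>2) = real p * real (card H)"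
proof -
  have fin: "finite H" using assms(2) finite_subset by blast
  have eq: "int p dvd int h - int h' \<longleftrightarrow> h' = h" if "h \<in> H" "h' \<in> H" for h h'
  proof -
    have "h < p" "h' < p" using that assms(2) by auto
    moreover have "int p dvd int h - int h' \<longleftrightarrow> [h = h'] (mod p)"
      by (simp add: cong_iff_dvd_diff flip: cong_int_iff)
    ultimately show ?thesis
      using cong_less_modulus_unique_nat[of h h' p] by auto
  qed
  have "complex_of_real (\<Sum>u<p. (norm (\<Sum>h\<in>H. add_char p (int u * int h)))\<^sup>2)
      = (\<Sum>u<p. (\<Sum>h\<in>H. add_char p (int u * int h)) * cnj (\<Sum>h\<in>H. add_char p (int u * int h)))"
    by (simp only: of_real_sum complex_norm_square)
  also have "\<dots> = (\<Sum>u<p. \<Sum>h\<in>H. \<Sum>h'\<in>H. add_char p (int u * (int h - int h')))"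
    by (simp add: sum_product cnj_add_char algebra_simps flip: add_char_add)
  also have "\<dots> = (\<Sum>h\<in>H. \<Sum>h'\<in>H. \<Sum>u<p. add_char p (int u * (int h - int h')))"
    by (subst sum.swap, rule sum.cong[OF refl], rule sum.swap)
  also have "\<dots> = (\<Sum>h\<in>H. \<Sum>h'\<in>H. if h' = h then of_nat p else 0)"
    using assms(1) eq by (intro sum.cong refl) (simp add: sum_add_char)
  also have "\<dots> = of_nat p * of_nat (card H)"
    using fin by simp
  also have "\<dots> = complex_of_real (real p * real (card H))" by simp
  finally show ?thesis by (simp only: of_real_eq_iff)
qed

text \<open>The sum is constant on the coset \<open>t H\<close>, and the Parseval identity bounds
  the total contribution of this coset.\<close>
lemma norm_subgroup_sum_le:
  assumes p: "prime p" and H: "H \<subseteq> {1..<p}"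
    and closed: "\<And>a b. a \<in> H \<Longrightarrow> b \<in> H \<Longrightarrow> a * b mod p \<in> H"
    and t: "\<not> p dvd t"
  shows "norm (\<Sum>h\<in>H. add_char p (int t * int h)) \<le> sqrt p"
proof (cases "H = {}")
  case False
  have p0: "p > 0" using p prime_gt_0_nat by blast
  have fin: "finite H" using H finite_subset by blast
  define S where "S u = norm (\<Sum>h\<in>H. add_char p (int u * int h))" for u :: nat
  have inj: "inj_on (\<lambda>h. c * h mod p) H" if "\<not> p dvd c" for c
  proof (rule inj_onI)
    fix x y assume xy: "x \<in> H" "y \<in> H" "c * x mod p = c * y mod p"
    have "coprime c p" using prime_imp_coprime_nat[OF p that] coprime_commute by blast
    hence "[x = y] (mod p)"
      using xy(3) cong_mult_lcancel_nat[of c p x y] by (simp add: Cong.cong_def)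
    moreover have "x < p" "y < p" using xy(1,2) H by auto
    ultimately show "x = y" by (rule cong_less_modulus_unique_nat)
  qed
  have ndvd: "\<not> p dvd a" if "a \<in> H" for a
    using that H nat_dvd_not_less[of a p] by auto
  have const: "S (t * a mod p) = S t" if a: "a \<in> H" for a
  proof -
    \<comment> \<open>Multiplication by \<open>a\<close> is injective modulo \<open>p\<close> and
      maps the finite set \<open>H\<close> into itself, so it permutes \<open>H\<close>; closure
      under products thus stands in for inverses.\<close>
    have bij: "bij_betw (\<lambda>h. a * h mod p) H H"
      using inj[OF ndvd[OF a]] closed[OF a] fin
      by (simp add: bij_betw_def card_subset_eq card_image endo_inj_surj image_subset_iff)
    have "(\<Sum>h\<in>H. add_char p (int (t * a mod p) * int h)) = (\<Sum>h\<in>H. add_char p (int t * int (a * h mod p)))"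
    proof (intro sum.cong refl add_char_cong p0)
      fix h
      have "[t * a mod p * h = t * (a * h mod p)] (mod p)"
        by (simp add: Cong.cong_def mod_mult_left_eq mod_mult_right_eq mult.assoc)
      thus "[int (t * a mod p) * int h = int t * int (a * h mod p)] (mod int p)"
        by (simp flip: cong_int_iff)
    qed
    also have "\<dots> = (\<Sum>h\<in>H. add_char p (int t * int h))"
      by (rule sum.reindex_bij_betw[OF bij])
    finally show ?thesis by (simp add: S_def)
  qed
  have "real (card H) * (S t)\<^sup>2 = (\<Sum>a\<in>H. (S (t * a mod p))\<^sup>2)"
    by (simp add: const)
  also have "\<dots> = (\<Sum>u\<in>(\<lambda>a. t * a mod p) ` H. (S u)\<^sup>2)"
    by (subst sum.reindex[OF inj[OF t]]) simp
  also have "\<dots> \<le> (\<Sum>u<p. (S u)\<^sup>2)"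
    using p0 by (intro sum_mono2) auto
  also have "\<dots> = real p * real (card H)"
    unfolding S_def using H p0 by (intro parseval_add_char) auto
  finally have "(S t)\<^sup>2 \<le> real p"
    using False fin by (simp add: mult.commute card_gt_0_iff)
  thus ?thesis
    unfolding S_def by (rule real_le_rsqrt)
qed simp

section \<open>Geometric sums of characters and completion\<close>

lemma sin_ge_half:
  fixes x :: real
  assumes "0 \<le> x" "x \<le> pi / 2"
  shows "x / 2 \<le> sin x"
proof -
  have "\<bar>sin x - (\<Sum>m<3. sin_coeff m * x ^ m)\<bar> \<le> inverse (fact 3) * \<bar>x\<bar> ^ 3"
    by (rule Maclaurin_sin_bound)
  hence "\<bar>sin x - x\<bar> \<le> x ^ 3 / 6"
    using assms(1) by (simp add: sin_coeff_def numeral_3_eq_3 fact_numeral)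
  hence "sin x \<ge> x - x ^ 3 / 6" by linarith
  \<comment> \<open>The number \<open>1.6\<close> bounds \<open>pi / 2\<close> from above, and
    \<open>1.6 ^ 2 / 6 < 1 / 2\<close> keeps the cubic term below \<open>x / 2\<close>.\<close>
  moreover have "x ^ 2 \<le> 1.6 ^ 2"
    using assms pi_approx by (intro power_mono) auto
  hence "x * x ^ 2 \<le> x * 1.6 ^ 2" using assms(1) by (rule mult_left_mono)
  hence "x ^ 3 \<le> x * 1.6 ^ 2" by (simp add: power3_eq_cube power2_eq_square)
  ultimately show ?thesis using assms(1) by (simp add: power2_eq_square)
qed

text \<open>Both sides are invariant under \<open>x \<mapsto> 1 - x\<close>, so
  \<open>x \<le> 1 / 2\<close> suffices. The product form is convenient because its reciprocal
  splits into partial fractions.\<close>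

lemma sin_pi_ge:
  fixes x :: real
  assumes "0 \<le> x" "x \<le> 1"
  shows "x * (1 - x) \<le> sin (pi * x)"
proof -
  have *: "y * (1 - y) \<le> sin (pi * y)" if "0 \<le> y" "y \<le> 1 / 2" for y :: real
  proof -
    have "y * (1 - y) \<le> y * 1"
      using that by (intro mult_left_mono) auto
    also have "\<dots> \<le> y * (pi / 2)"
      using that pi_gt3 by (intro mult_left_mono) auto
    also have "\<dots> = pi * y / 2" by simp
    also have "\<dots> \<le> sin (pi * y)"
      using that by (intro sin_ge_half) (auto simp: field_simps)
    finally show ?thesis .
  qed
  show ?thesis
  proof (cases "x \<le> 1 / 2")
    case False
    have "sin (pi * (1 - x)) = sin (pi * x)"
      by (simp add: right_diff_distrib sin_diff)
    thus ?thesis using *[of "1 - x"] assms False by (simp add: mult.commute)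
  qed (use * assms in auto)
qed

text \<open>The chord from 1 to the point of the unit circle at angle \<open>2 * pi * x\<close> has
  length \<open>2 * sin (pi * x)\<close>, here with \<open>x = u / p\<close>.\<close>

lemma norm_one_minus_add_char_ge:
  assumes "0 < u" "u < p"
  shows "2 * (real u / real p) * (1 - real u / real p) \<le> norm (1 - add_char p (int u))"
proof -
  define x where "x = real u / real p"
  have x: "0 \<le> x" "x \<le> 1" using assms by (auto simp: x_def)
  have identity: "(1 - (1 - 2 * s\<^sup>2))\<^sup>2 + (2 * s * c)\<^sup>2 = (2 * s)\<^sup>2 * (s\<^sup>2 + c\<^sup>2)" for s c :: real
    by (simp add: algebra_simps power2_eq_square)
  have "(norm (1 - add_char p (int u)))\<^sup>2 = (1 - cos (2 * (pi * x)))\<^sup>2 + (sin (2 * (pi * x)))\<^sup>2"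
    by (simp add: add_char_def cmod_power2 x_def mult.assoc)
  also have "\<dots> = (2 * sin (pi * x))\<^sup>2 * ((sin (pi * x))\<^sup>2 + (cos (pi * x))\<^sup>2)"
    unfolding cos_double_sin sin_double by (rule identity)
  finally have "(norm (1 - add_char p (int u)))\<^sup>2 = (2 * sin (pi * x))\<^sup>2"
    by (simp only: sin_cos_squared_add mult_1_right)
  from arg_cong[OF this, of sqrt] have "norm (1 - add_char p (int u)) = \<bar>2 * sin (pi * x)\<bar>"
    by (simp only: real_sqrt_abs abs_norm_cancel)
  moreover have "x * (1 - x) \<le> sin (pi * x)" using x by (rule sin_pi_ge)
  moreover have "0 \<le> x * (1 - x)" using x by simp
  ultimately have "2 * (x * (1 - x)) \<le> norm (1 - add_char p (int u))"
    by linarith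
  thus ?thesis by (simp add: x_def mult.assoc)
qed

text \<open>The telescoped numerator is a difference of two numbers of modulus 1, so the bound does
  not depend on the length \<open>M\<close>.\<close>

lemma norm_sum_power_le:
  fixes z :: complex
  assumes "norm z = 1" "z \<noteq> 1"
  shows "norm (\<Sum>m=1..M. z ^ m) \<le> 2 / norm (1 - z)"
proof -
  have "(\<Sum>m=1..M. z ^ m) * (1 - z) = z - z ^ Suc M"
    using sum_gp_multiplied[of 1 M z] by (cases "M = 0") (simp_all add: mult.commute)
  hence "(\<Sum>m=1..M. z ^ m) = (z - z ^ Suc M) / (1 - z)"
    using assms(2) by (simp add: eq_divide_eq)
  moreover have "norm (z - z ^ Suc M) \<le> 1 + 1"
    using norm_triangle_ineq4[of z "z ^ Suc M"] assms(1) by (simp add: norm_mult norm_power)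
  ultimately show ?thesis
    by (simp add: norm_divide divide_right_mono)
qed

text \<open>The difference \<open>harm n - ln n\<close> decreases in \<open>n\<close> and equals 1
  at \<open>n = 1\<close>.\<close>

lemma harm_le:
  assumes "n > 0"
  shows "harm n \<le> 1 + ln (real n)"
proof -
  have "harm (Suc (n - 1)) - ln (real (Suc (n - 1))) \<le> harm (Suc 0) - ln (real (Suc 0))"
    by (rule decseqD[OF decseq_harm_diff_ln]) simp
  thus ?thesis using assms by (simp add: harm_expand(1) harm_Suc[of 0] del: harm_Suc)
qed

text \<open>Multiplication by \<open>c\<close> permutes the nonzero residues, so it suffices to
  treat geometric sums with ratio \<open>add_char p u\<close>. Each is at most
  \<open>p / u + p / (p - u)\<close>, and the two resulting harmonic sums produce the
  logarithm.\<close>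

lemma sum_norm_incomplete_le:
  assumes p: "prime p" and c: "\<not> p dvd c"
  shows "(\<Sum>t=1..<p. norm (\<Sum>m=1..M. add_char p (int t * int (c * m)))) \<le> 2 * real p * (1 + ln (real p))"
proof -
  have p0: "p > 0" and p1: "p > 1" using p prime_gt_0_nat prime_gt_1_nat by blast+
  have cp: "coprime c p" using prime_imp_coprime_nat[OF p c] coprime_commute by blast
  define g where "g u = norm (\<Sum>m=1..M. add_char p (int u) ^ m)" for u :: nat
  have "inj_on (\<lambda>t. t * c mod p) {1..<p}"
  proof (rule inj_onI)
    fix x y assume xy: "x \<in> {1..<p}" "y \<in> {1..<p}" "x * c mod p = y * c mod p"
    hence "[x = y] (mod p)"
      using cp cong_mult_rcancel_nat[of c p x y] by (simp add: Cong.cong_def)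
    moreover have "x < p" "y < p" using xy(1,2) by auto
    ultimately show "x = y" by (rule cong_less_modulus_unique_nat)
  qed
  moreover have "(\<lambda>t. t * c mod p) ` {1..<p} \<subseteq> {1..<p}"
  proof safe
    fix t assume "t \<in> {1..<p}"
    hence "\<not> p dvd t * c" using c p by (auto simp: prime_dvd_mult_iff dest: dvd_imp_le)
    thus "t * c mod p \<in> {1..<p}" using p0 by (auto simp: mod_greater_zero_iff_not_dvd Suc_le_eq)
  qed
  ultimately have bij: "bij_betw (\<lambda>t. t * c mod p) {1..<p} {1..<p}"
    by (simp add: bij_betw_def endo_inj_surj)
  have "(\<Sum>t=1..<p. norm (\<Sum>m=1..M. add_char p (int t * int (c * m)))) = (\<Sum>t=1..<p. g (t * c mod p))"
  proof (intro sum.cong refl)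
    fix t
    have "add_char p (int t * int (c * m)) = add_char p (int (t * c mod p)) ^ m" for m
      unfolding add_char_power
    proof (rule add_char_cong[OF p0])
      have "[t * (c * m) = m * (t * c mod p)] (mod p)"
        by (simp add: Cong.cong_def mod_mult_right_eq mult_ac)
      thus "[int t * int (c * m) = int m * int (t * c mod p)] (mod int p)"
        by (simp flip: cong_int_iff)
    qed
    thus "norm (\<Sum>m=1..M. add_char p (int t * int (c * m))) = g (t * c mod p)"
      by (simp add: g_def)
  qed
  also have "\<dots> = (\<Sum>u=1..<p. g u)"
    by (rule sum.reindex_bij_betw[OF bij])
  also have "\<dots> \<le> (\<Sum>u=1..<p. real p * (inverse (real u) + inverse (real (p - u))))"
  proof (intro sum_mono)
    fix u assume "u \<in> {1..<p}"
    hence u: "0 < u" "u < p" by auto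
    define x where "x = real u / real p"
    have x: "0 < x" "x < 1" using u by (auto simp: x_def)
    have "add_char p (int u) \<noteq> 1"
      using u p0 by (auto simp: add_char_eq_1_iff dest: dvd_imp_le)
    hence "g u \<le> 2 / norm (1 - add_char p (int u))"
      unfolding g_def by (intro norm_sum_power_le) auto
    also have "\<dots> \<le> 2 / (2 * x * (1 - x))"
      using norm_one_minus_add_char_ge[OF u] x \<open>add_char p (int u) \<noteq> 1\<close>
      by (intro divide_left_mono mult_pos_pos) (auto simp: x_def)
    \<comment> \<open>Partial fractions separate the singularities at both ends of the
      range.\<close>
    also have "\<dots> = inverse x + inverse (1 - x)"
      using x by (simp add: field_simps)
    also have "\<dots> = real p * (inverse (real u) + inverse (real (p - u)))"
      using u by (simp add: x_def field_simps of_nat_diff)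
    finally show "g u \<le> real p * (inverse (real u) + inverse (real (p - u)))" .
  qed
  also have "\<dots> = real p * ((\<Sum>u=1..<p. inverse (real u)) + (\<Sum>u=1..<p. inverse (real (p - u))))"
    by (simp add: sum_distrib_left sum.distrib distrib_left)
  also have "(\<Sum>u=1..<p. inverse (real (p - u))) = (\<Sum>u=1..<p. inverse (real u))"
    by (rule sum.reindex_bij_witness[of _ "\<lambda>u. p - u" "\<lambda>u. p - u"]) auto
  also have "(\<Sum>u=1..<p. inverse (real u)) = harm (p - 1)"
    using p0 by (auto simp: harm_def intro!: sum.cong)
  also have "harm (p - 1) \<le> 1 + ln (real p)"
    using harm_le[of "p - 1"] p1 by (smt (verit) ln_mono of_nat_0_less_iff of_nat_mono diff_le_self zero_less_diff)
  hence "real p * (harm (p - 1) + harm (p - 1)) \<le> real p * ((1 + ln (real p)) + (1 + ln (real p)))"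
    by (intro mult_left_mono) auto
  finally show ?thesis by (simp add: algebra_simps)
qed

text \<open>The multiples of \<open>c\<close> in \<open>P\<close> are the \<open>n = c * m\<close>
  with \<open>1 \<le> m \<le> M\<close>. When this equation is detected by additive characters,
  frequency 0 gives the main term. Every other frequency pairs a sum over \<open>P\<close>, at most
  \<open>B\<close>, with an incomplete sum over multiples of \<open>c\<close>, controlled on average
  by \<open>sum_norm_incomplete_le\<close>.\<close>

lemma card_multiples_deviation_le:
  assumes p: "prime p" and P: "P \<subseteq> {1..<p}" and c: "\<not> p dvd c"
    and B: "\<And>t. t \<in> {1..<p} \<Longrightarrow> norm (\<Sum>n\<in>P. add_char p (int t * int n)) \<le> B"
  shows "\<bar>real (card {n \<in> P. c dvd n}) - real (card P) * real ((p - 1) div c) / real p\<bar>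
           \<le> 2 * B * (1 + ln (real p))"
proof -
  have p0: "p > 0" using p prime_gt_0_nat by blast
  have c0: "c > 0" using c by (cases "c = 0") auto
  have fin: "finite P" using P finite_subset by blast
  define M where "M = (p - 1) div c"
  define F where "F t = (\<Sum>n\<in>P. add_char p (int t * int n))" for t :: nat
  define S where "S t = (\<Sum>m=1..M. add_char p (int t * int (c * m)))" for t :: nat
  have small: "c * m < p" if "m \<in> {1..M}" for m
  proof -
    have "c * m \<le> c * M" using that by simp
    also have "\<dots> \<le> p - 1" by (simp add: M_def)
    finally show ?thesis using p0 by simp
  qed
  \<comment> \<open>Both numbers lie below \<open>p\<close>, so congruence modulo \<open>p\<close>
    is equality.\<close>
  have dvd_iff: "int p dvd int n - int (c * m) \<longleftrightarrow> n = c * m" if "n \<in> P" "m \<in> {1..M}" for n m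
  proof -
    have "n < p" "c * m < p" using that P small by auto
    moreover have "int p dvd int n - int (c * m) \<longleftrightarrow> [n = c * m] (mod p)"
      by (simp add: cong_iff_dvd_diff flip: cong_int_iff)
    ultimately show ?thesis
      using cong_less_modulus_unique_nat[of n "c * m" p] by auto
  qed
  have count: "(\<Sum>m=1..M. if n = c * m then of_nat p else 0) = (if c dvd n then of_nat p else (0::complex))"
    if n: "n \<in> P" for n
  proof (cases "c dvd n")
    case True
    then obtain k where k: "n = c * k" ..
    have "n \<in> {1..<p}" using n P by blast
    hence "1 \<le> k" "c * k \<le> p - 1" using k by (auto intro!: Suc_leI Nat.gr0I)
    hence "k \<in> {1..M}" using c0 by (simp add: M_def less_eq_div_iff_mult_less_eq mult.commute)
    thus ?thesis using k c0 by simp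
  qed (auto intro!: sum.neutral)
  have "complex_of_real (real p * real (card {n \<in> P. c dvd n})) = (\<Sum>n\<in>P. if c dvd n then of_nat p else 0)"
    using fin by (simp add: sum.If_cases Int_def)
  also have "\<dots> = (\<Sum>n\<in>P. \<Sum>m=1..M. \<Sum>t<p. add_char p (int t * (int n - int (c * m))))"
  proof (intro sum.cong refl)
    fix n assume n: "n \<in> P"
    have "(\<Sum>m=1..M. \<Sum>t<p. add_char p (int t * (int n - int (c * m)))) = (\<Sum>m=1..M. if n = c * m then of_nat p else 0)"
      by (rule sum.cong[OF refl]) (simp only: sum_add_char[OF p0] dvd_iff[OF n])
    thus "(if c dvd n then of_nat p else 0) = (\<Sum>m=1..M. \<Sum>t<p. add_char p (int t * (int n - int (c * m))))"
      by (simp only: count[OF n])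
  qed
  also have "\<dots> = (\<Sum>t<p. \<Sum>n\<in>P. \<Sum>m=1..M. add_char p (int t * (int n - int (c * m))))"
    by (rule trans[OF sum.cong[OF refl sum.swap] sum.swap])
  also have "\<dots> = (\<Sum>t<p. F t * cnj (S t))"
    unfolding F_def S_def cnj_sum sum_product cnj_add_char
    by (simp add: algebra_simps flip: add_char_add)
  also have "{..<p} = insert 0 {1..<p}" using p0 by auto
  also have "(\<Sum>t\<in>insert 0 {1..<p}. F t * cnj (S t)) = F 0 * cnj (S 0) + (\<Sum>t=1..<p. F t * cnj (S t))"
    by (rule sum.insert) auto
  also have "F 0 * cnj (S 0) = complex_of_real (real (card P) * real M)"
    by (simp add: F_def S_def)
  finally have "complex_of_real (real p * real (card {n \<in> P. c dvd n}) - real (card P) * real M)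
      = (\<Sum>t=1..<p. F t * cnj (S t))" by simp
  hence "\<bar>real p * real (card {n \<in> P. c dvd n}) - real (card P) * real M\<bar> = norm (\<Sum>t=1..<p. F t * cnj (S t))"
    by (metis norm_of_real)
  also have "\<dots> \<le> (\<Sum>t=1..<p. norm (F t) * norm (S t))"
    by (rule order_trans[OF norm_sum]) (simp add: norm_mult)
  also have "\<dots> \<le> (\<Sum>t=1..<p. B * norm (S t))"
    using B by (intro sum_mono mult_right_mono) (auto simp: F_def)
  also have "\<dots> = B * (\<Sum>t=1..<p. norm (S t))" by (simp add: sum_distrib_left)
  also have "\<dots> \<le> B * (2 * real p * (1 + ln (real p)))"
  proof (rule mult_left_mono)
    show "(\<Sum>t=1..<p. norm (S t)) \<le> 2 * real p * (1 + ln (real p))"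
      unfolding S_def by (rule sum_norm_incomplete_le[OF p c])
    \<comment> \<open>Nonnegativity of \<open>B\<close> follows from its defining bound at frequency
      1.\<close>
    have "1 \<in> {1..<p}" using prime_gt_1_nat[OF p] by simp
    thus "0 \<le> B" using B[of 1] norm_ge_zero order_trans by blast
  qed
  finally have "\<bar>real p * real (card {n \<in> P. c dvd n}) - real (card P) * real M\<bar> / real p \<le> 2 * B * (1 + ln (real p))"
    using p0 by (simp add: divide_le_eq mult_ac)
  moreover have "real (card {n \<in> P. c dvd n}) - real (card P) * real M / real p
      = (real p * real (card {n \<in> P. c dvd n}) - real (card P) * real M) / real p"
    using p0 by (simp add: field_simps)
  ultimately show ?thesis by (simp add: M_def)
qed

subsection \<open>Primitive roots\<close>

text \<open>The order divides \<open>p - 1\<close>. If it is a proper divisor, some prime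
  \<open>q\<close> divides the cofactor, and then the order already divides
  \<open>(p - 1) div q\<close>.\<close>

lemma ord_eq_iff_prime_factors:
  assumes p: "prime p" and n: "n \<in> {1..<p}"
  shows "ord p n = p - 1 \<longleftrightarrow> (\<forall>q\<in>prime_factors (p - 1). \<not> [n ^ ((p - 1) div q) = 1] (mod p))"
proof (intro iffI ballI notI)
  fix q assume ord: "ord p n = p - 1" and q: "q \<in> prime_factors (p - 1)" and "[n ^ ((p - 1) div q) = 1] (mod p)"
  hence "ord p n dvd (p - 1) div q" by (simp only: ord_divides)
  hence dvd: "p - 1 dvd (p - 1) div q" by (simp only: ord)
  have q': "prime q" "q dvd p - 1" "p - 1 > 0" using q prime_gt_1_nat[OF p] by (auto simp: prime_factors_dvd)
  have "(p - 1) div q < p - 1" using q' prime_gt_1_nat[of q] by (intro div_less_dividend) auto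
  moreover have "(p - 1) div q > 0" using q' by (simp add: dvd_imp_le div_greater_zero_iff prime_gt_0_nat)
  ultimately show False using dvd nat_dvd_not_less by blast
next
  assume *: "\<forall>q\<in>prime_factors (p - 1). \<not> [n ^ ((p - 1) div q) = 1] (mod p)"
  have p1: "p > 1" using p by (rule prime_gt_1_nat)
  have "\<not> p dvd n" using n nat_dvd_not_less[of n p] by auto
  hence "ord p n dvd p - 1" using fermat_theorem[OF p] by (simp only: ord_divides simp_thms)
  then obtain k where k: "p - 1 = ord p n * k" ..
  have "k = 1"
  proof (rule ccontr)
    assume "k \<noteq> 1"
    then obtain q where q: "prime q" "q dvd k" using prime_factor_nat by blast
    have "q dvd p - 1" using q by (simp add: k del: One_nat_def)
    hence qp: "q \<in> prime_factors (p - 1)" using q p1 by (intro prime_factorsI) auto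
    have "(p - 1) div q = ord p n * (k div q)" using q k by (simp add: div_mult_swap)
    hence "[n ^ ((p - 1) div q) = 1] (mod p)" by (simp only: ord_divides dvd_triv_left)
    thus False using * qp by blast
  qed
  thus "ord p n = p - 1" using k by simp
qed

text \<open>The set \<open>H T\<close> of all \<open>n\<close> that violate the primitive root criterion at every \<open>q \<in> T\<close> is a subgroup.\<close>
lemma norm_primitive_root_sum_le:
  assumes p: "prime p" and t: "\<not> p dvd t"
  shows "norm (\<Sum>n | n \<in> {1..<p} \<and> ord p n = p - 1. add_char p (int t * int n))
           \<le> 2 ^ card (prime_factors (p - 1)) * sqrt (real p)"
proof -
  define Q where "Q = prime_factors (p - 1)"
  define H where "H T = {n \<in> {1..<p}. \<forall>q\<in>T. [n ^ ((p - 1) div q) = 1] (mod p)}" for T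
  define ind where "ind q n = (if [n ^ ((p - 1) div q) = 1] (mod p) then 1 else 0 :: complex)" for q n
  define f where "f n = add_char p (int t * int n)" for n
  have finQ: "finite Q" by (simp add: Q_def)
  have ind_prod: "(\<Prod>q\<in>T. ind q n) = (if \<forall>q\<in>T. [n ^ ((p - 1) div q) = 1] (mod p) then 1 else 0)"
    if "finite T" for T n
    using that by induction (auto simp: ind_def)
  have indicator: "(if ord p n = p - 1 then 1 else 0) = (\<Prod>q\<in>Q. 1 - ind q n)" if "n \<in> {1..<p}" for n
    unfolding ord_eq_iff_prime_factors[OF p that] Q_def[symmetric]
    using finQ by induction (auto simp: ind_def)
  have "(\<Sum>n | n \<in> {1..<p} \<and> ord p n = p - 1. f n) = (\<Sum>n\<in>{1..<p}. (if ord p n = p - 1 then 1 else 0) * f n)"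
    by (rule sum.mono_neutral_cong_left) auto
  \<comment> \<open>Expanding the product of \<open>1 - ind q n\<close> over \<open>Q\<close> is
    inclusion-exclusion: each subset \<open>T\<close> contributes, up to sign, the indicator of
    \<open>H T\<close>.\<close>
  also have "\<dots> = (\<Sum>n\<in>{1..<p}. (\<Sum>T\<in>Pow Q. (-1) ^ card T * (\<Prod>q\<in>T. ind q n)) * f n)"
  proof (intro sum.cong refl arg_cong2[where f = "(*)"])
    fix n assume "n \<in> {1..<p}"
    hence "(if ord p n = p - 1 then 1 else 0) = (\<Prod>q\<in>Q. 1 - ind q n)" by (rule indicator)
    also have "\<dots> = (\<Sum>T\<in>Pow Q. (-1) ^ card T * (\<Prod>q\<in>T. ind q n))"
      by (simp only: prod_diff_conv_sum[OF finQ]) simp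
    finally show "(if ord p n = p - 1 then 1 else 0) = (\<Sum>T\<in>Pow Q. (-1) ^ card T * (\<Prod>q\<in>T. ind q n))" .
  qed
  also have "\<dots> = (\<Sum>T\<in>Pow Q. (-1) ^ card T * (\<Sum>n\<in>{1..<p}. (\<Prod>q\<in>T. ind q n) * f n))"
    by (simp add: sum_distrib_left sum_distrib_right mult.assoc) (rule sum.swap)
  also have "\<dots> = (\<Sum>T\<in>Pow Q. (-1) ^ card T * (\<Sum>n\<in>H T. f n))"
  proof (rule sum.cong[OF refl])
    fix T assume "T \<in> Pow Q"
    hence "finite T" using finQ finite_subset by blast
    hence "(\<Sum>n\<in>{1..<p}. (\<Prod>q\<in>T. ind q n) * f n) = (\<Sum>n\<in>H T. f n)"
      by (intro sum.mono_neutral_cong_right) (auto simp: H_def ind_prod)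
    thus "(-1) ^ card T * (\<Sum>n\<in>{1..<p}. (\<Prod>q\<in>T. ind q n) * f n) = (-1) ^ card T * (\<Sum>n\<in>H T. f n)"
      by (simp only:)
  qed
  \<comment> \<open>The triangle inequality costs the number of subsets of \<open>Q\<close>, which
    is the factor \<open>2 ^ card Q\<close>.\<close>
  also have "norm \<dots> \<le> (\<Sum>T\<in>Pow Q. norm (\<Sum>n\<in>H T. f n))"
    by (rule order_trans[OF norm_sum]) (simp add: norm_mult norm_power)
  also have "\<dots> \<le> (\<Sum>T\<in>Pow Q. sqrt (real p))"
  proof (rule sum_mono)
    fix T
    show "norm (\<Sum>n\<in>H T. f n) \<le> sqrt (real p)"
      unfolding f_def
    proof (rule norm_subgroup_sum_le[OF p _ _ t])
      fix a b assume ab: "a \<in> H T" "b \<in> H T"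
      have "\<not> p dvd a" "\<not> p dvd b" using ab nat_dvd_not_less[of _ p] by (auto simp: H_def)
      hence "\<not> p dvd a * b" using p by (simp add: prime_dvd_mult_iff)
      moreover have "[(a * b mod p) ^ k = 1] (mod p)" if "[a ^ k = 1] (mod p)" "[b ^ k = 1] (mod p)" for k
        using cong_mult[OF that] by (simp add: Cong.cong_def power_mod power_mult_distrib)
      ultimately show "a * b mod p \<in> H T"
        using ab prime_gt_0_nat[OF p] by (auto simp: H_def mod_greater_zero_iff_not_dvd Suc_le_eq)
    qed (auto simp: H_def)
  qed
  also have "\<dots> = 2 ^ card Q * sqrt (real p)"
    using finQ by (simp add: card_Pow)
  finally show ?thesis by (simp add: f_def Q_def)
qed

lemma card_primitive_roots:
  assumes "prime p"
  shows "card {n \<in> {1..<p}. ord p n = p - 1} = totient (p - 1)"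
proof -
  have "{n \<in> {1..<p}. ord p n = p - 1} = {n \<in> totatives p. ord p n = p - 1}"
    using assms by (auto simp: totatives_prime)
  thus ?thesis
    using prime_card_elements_with_ord_eq_totient[OF prime_gt_1_nat[OF assms] assms, of "p - 1"] by simp
qed

subsection \<open>Prime factors\<close>

text \<open>Powers of distinct primes are coprime. Exponent 1 serves the bound on
  \<open>2 ^ \<omega>\<close>, general \<open>s\<close> the Moebius identity.\<close>

lemma prod_primes_power_dvd:
  fixes n :: nat
  assumes "finite T" "\<And>q. q \<in> T \<Longrightarrow> prime q" "\<And>q. q \<in> T \<Longrightarrow> q ^ s dvd n"
  shows "(\<Prod>T) ^ s dvd n"
  using assms
proof (induction T)
  case (insert q T)
  have "coprime q (\<Prod>T)"
    using insert.hyps insert.prems(1) by (intro prod_coprime_right) (auto intro: primes_coprime)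
  hence "q ^ s * (\<Prod>T) ^ s dvd n"
    using insert by (intro divides_mult) auto
  thus ?case using insert.hyps by (simp add: power_mult_distrib)
qed simp

text \<open>With \<open>prod_prime_factors_squarefree\<close>, this makes taking products and taking
  prime factors inverse to each other between finite sets of primes and squarefree numbers.\<close>

lemma prime_factors_prod_primes:
  fixes T :: "nat set"
  assumes "finite T" "\<And>q. q \<in> T \<Longrightarrow> prime q"
  shows "prime_factors (\<Prod>T) = T"
proof -
  have "\<Prod>T \<noteq> 0" using assms(1) assms(2)[of 0] by auto
  moreover have "q dvd \<Prod>T \<longleftrightarrow> q \<in> T" if "prime q" for q
    using that assms primes_dvd_imp_eq[OF that assms(2)] by (auto simp: prime_dvd_prod_iff intro: bexI[of _ q])
  ultimately show ?thesis
    using assms(2) by (auto simp: prime_factors_dvd)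
qed

lemma prod_prime_factors_squarefree:
  fixes d :: nat
  assumes "squarefree d"
  shows "\<Prod>(prime_factors d) = d"
proof -
  have "d \<noteq> 0" using assms by (intro notI) simp
  have "d = (\<Prod>q\<in>prime_factors d. q ^ multiplicity q d)"
    using \<open>d \<noteq> 0\<close> by (simp add: prime_factorization_nat)
  also have "\<dots> = (\<Prod>q\<in>prime_factors d. q)"
    using assms \<open>d \<noteq> 0\<close> by (intro prod.cong) (auto simp: squarefree_factorial_semiring')
  finally show ?thesis by simp
qed

text \<open>Each prime factor \<open>q \<ge> 2 ^ K\<close> pays for its factor \<open>2 \<le> q powr (1 / K)\<close>; there are fewer
  than \<open>2 ^ K\<close> others.\<close>
lemma two_power_omega_bound:
  fixes K :: nat
  assumes "K > 0"
  obtains C :: real where "C > 0"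
    "\<And>n. n > 0 \<Longrightarrow> 2 ^ card (prime_factors n) \<le> C * real n powr (1 / real K)"
proof
  show "(2::real) ^ (2 ^ K) > 0" by simp
  fix n :: nat assume n: "n > 0"
  define A where "A = {q \<in> prime_factors n. q < 2 ^ K}"
  define B where "B = {q \<in> prime_factors n. 2 ^ K \<le> q}"
  have fin: "finite A" "finite B" by (auto simp: A_def B_def)
  have split: "prime_factors n = A \<union> B" "A \<inter> B = {}" by (auto simp: A_def B_def)
  have "card A \<le> card {..<(2::nat) ^ K}" by (rule card_mono) (auto simp: A_def)
  hence "card A \<le> 2 ^ K" by simp
  hence A: "(2::real) ^ card A \<le> 2 ^ (2 ^ K)" by (rule power_increasing) simp
  have "(2::real) ^ card B = (\<Prod>q\<in>B. 2)" by simp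
  also have "\<dots> \<le> (\<Prod>q\<in>B. real q powr (1 / real K))"
  proof (rule prod_mono)
    fix q assume "q \<in> B"
    hence "(2::real) ^ K \<le> real q"
      unfolding B_def by (metis (no_types, lifting) mem_Collect_eq of_nat_le_iff of_nat_numeral of_nat_power)
    hence "(2 ^ K) powr (1 / real K) \<le> real q powr (1 / real K)" by (intro powr_mono2) auto
    moreover have "(2 ^ K) powr (1 / real K) = (2::real)"
      using assms by (simp add: powr_powr flip: powr_realpow)
    ultimately show "0 \<le> (2::real) \<and> 2 \<le> real q powr (1 / real K)" by simp
  qed
  also have "\<dots> = real (\<Prod>B) powr (1 / real K)"
    by (simp add: prod_powr_distrib)
  also have "\<dots> \<le> real n powr (1 / real K)"
  proof (intro powr_mono2)
    have "(\<Prod>B) ^ 1 dvd n" using fin by (intro prod_primes_power_dvd) (auto simp: B_def)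
    hence "\<Prod>B \<le> n" using n by (simp add: dvd_imp_le)
    thus "real (\<Prod>B) \<le> real n" by (simp only: of_nat_le_iff)
  qed (auto intro!: prod_nonneg)
  finally have "(2::real) ^ card B \<le> real n powr (1 / real K)" .
  hence "(2::real) ^ card A * 2 ^ card B \<le> 2 ^ (2 ^ K) * real n powr (1 / real K)"
    using A by (intro mult_mono) auto
  thus "2 ^ card (prime_factors n) \<le> 2 ^ (2 ^ K) * real n powr (1 / real K)"
    using fin split(2) by (simp add: split(1) card_Un_disjoint power_add)
qed

text \<open>In the product formula for the totient, each factor \<open>1 - 1 / q\<close> is at least
  \<open>1 / 2\<close>.\<close>

lemma totient_ratio_ge:
  assumes "n > 0"
  shows "real (totient n) / real n \<ge> 1 / 2 ^ card (prime_factors n)"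
proof -
  have "1 / 2 ^ card (prime_factors n) = (\<Prod>q\<in>prime_factors n. 1 / 2 :: real)"
    by (simp add: power_divide)
  also have "\<dots> \<le> (\<Prod>q\<in>prime_factors n. 1 - 1 / real q)"
  proof (rule prod_mono)
    fix q assume "q \<in> prime_factors n"
    hence "q \<ge> 2" by (simp add: prime_ge_2_nat in_prime_factors_iff)
    thus "0 \<le> (1 / 2 :: real) \<and> 1 / 2 \<le> 1 - 1 / real q" by (simp add: field_simps)
  qed
  finally show ?thesis using assms by (simp add: totient_formula2)
qed

subsection \<open>The Moebius function and the zeta function\<close>

text \<open>Real-valued because it only enters real sums; its value at 0 is 0, as 0 is not
  squarefree.\<close>

definition moebius_mu :: "nat \<Rightarrow> real" where
  "moebius_mu d = (if squarefree d then (-1) ^ card (prime_factors d) else 0)"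

lemma abs_moebius_le: "\<bar>moebius_mu d\<bar> \<le> 1"
  by (simp add: moebius_mu_def)

text \<open>A squarefree \<open>d\<close> satisfies \<open>d ^ s dvd n\<close> exactly when all its
  prime factors lie in \<open>Q\<close>. The sum is therefore an alternating sum over the subsets of
  \<open>Q\<close>, which vanishes unless \<open>Q\<close> is empty.\<close>

lemma sum_moebius_power_dvd:
  assumes n: "n > 0" and s: "s > 0"
  shows "(\<Sum>d | d ^ s dvd n. moebius_mu d) = real (mu_power_free s n)"
proof -
  define Q where "Q = {q. prime q \<and> q ^ s dvd n}"
  have le: "d \<le> n" if "d ^ s dvd n" for d
  proof (cases "d = 0")
    case False
    hence "d ^ 1 \<le> d ^ s" using s by (intro power_increasing) auto
    thus ?thesis using dvd_imp_le[OF that n] by simp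
  qed simp
  have finQ: "finite Q"
    by (rule finite_subset[of _ "{..n}"]) (auto simp: Q_def le)
  have fin: "finite {d. d ^ s dvd n}"
    by (rule finite_subset[of _ "{..n}"]) (auto simp: le)
  have T: "finite T" "\<And>q. q \<in> T \<Longrightarrow> prime q" "\<And>q. q \<in> T \<Longrightarrow> q ^ s dvd n" if "T \<in> Pow Q" for T
    using that finQ finite_subset by (auto simp: Q_def)
  have sqf: "squarefree (\<Prod>T)" if "T \<in> Pow Q" for T
    using T[OF that] by (intro squarefree_prod_coprime) (auto intro: primes_coprime squarefree_prime)
  have "(\<Sum>d | d ^ s dvd n. moebius_mu d) = (\<Sum>d | d ^ s dvd n \<and> squarefree d. (-1) ^ card (prime_factors d))"
    using fin by (intro sum.mono_neutral_cong_right) (auto simp: moebius_mu_def)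
  also have "\<dots> = (\<Sum>T\<in>Pow Q. (-1) ^ card T)"
  proof (rule sum.reindex_bij_witness[of _ "\<lambda>T. \<Prod>T" prime_factors])
    fix d assume d: "d \<in> {d. d ^ s dvd n \<and> squarefree d}"
    thus "\<Prod>(prime_factors d) = d" by (simp add: prod_prime_factors_squarefree)
    have "q ^ s dvd n" if "q dvd d" for q
      using d dvd_trans[OF dvd_power_same[OF that]] by blast
    thus "prime_factors d \<in> Pow Q" by (auto simp: Q_def in_prime_factors_iff)
  next
    fix T assume TQ: "T \<in> Pow Q"
    show "prime_factors (\<Prod>T) = T" using T[OF TQ] by (intro prime_factors_prod_primes)
    show "\<Prod>T \<in> {d. d ^ s dvd n \<and> squarefree d}"
      using sqf[OF TQ] prod_primes_power_dvd[OF T[OF TQ]] by simp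
  qed simp
  also have "\<dots> = (\<Prod>q\<in>Q. 1 - 1)"
    by (simp only: prod_diff_conv_sum[OF finQ]) simp
  also have "\<dots> = real (mu_power_free s n)"
  proof -
    have "power_free s n \<longleftrightarrow> Q = {}" by (auto simp: power_free_def Q_def)
    thus ?thesis using finQ by (simp add: mu_power_free_def card_gt_0_iff power_0_left)
  qed
  finally show ?thesis .
qed

text \<open>The case \<open>s = 1\<close> of the preceding identity: only 1 has no prime
  divisor.\<close>

lemma sum_moebius_divisors:
  assumes "n > 0"
  shows "(\<Sum>d | d dvd n. moebius_mu d) = (if n = 1 then 1 else 0)"
proof -
  have "power_free 1 n \<longleftrightarrow> n = 1"
    unfolding power_free_def using prime_factor_nat[of n] by auto
  thus ?thesis
    using sum_moebius_power_dvd[of n 1] assms by (simp add: mu_power_free_def)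
qed

section \<open>Zeta and its inverse as Dirichlet series\<close>

lemma summable_on_inverse_power:
  assumes "s \<ge> 2"
  shows "(\<lambda>n::nat. 1 / real n ^ s) summable_on {1..}"
proof -
  have "summable (\<lambda>n. norm (1 / real n ^ s))"
    using inverse_power_summable[OF assms, where 'a = real] by (simp add: field_simps)
  hence "(\<lambda>n::nat. 1 / real n ^ s) summable_on UNIV"
    by (rule norm_summable_imp_summable_on)
  thus ?thesis by (rule summable_on_subset_banach) simp
qed

text \<open>An unordered sum over the positive integers can be multiplied and regrouped by divisors,
  unlike the ordered series in the definition.\<close>

lemma riemann_zeta_conv_infsum:
  assumes "s \<ge> 2"
  shows "riemann_zeta (real s) = infsum (\<lambda>n. 1 / real n ^ s) {1..}"
proof -
  have bij: "bij_betw Suc UNIV {1..}"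
    by (rule bij_betwI[of _ _ _ "\<lambda>n. n - 1"]) auto
  have sm: "summable (\<lambda>n. norm (1 / real (Suc n) ^ s))"
    using inverse_power_summable[OF assms, where 'a = real]
    by (subst summable_Suc_iff) (simp add: field_simps)
  hence "((\<lambda>n. 1 / real (Suc n) ^ s) has_sum (\<Sum>n. 1 / real (Suc n) ^ s)) UNIV"
    by (intro norm_summable_imp_has_sum summable_sums summable_norm_cancel[OF sm]) auto
  hence "((\<lambda>n. 1 / real n ^ s) has_sum (\<Sum>n. 1 / real (Suc n) ^ s)) {1..}"
    using has_sum_reindex_bij_betw[OF bij, of "\<lambda>n. 1 / real n ^ s"] by simp
  moreover have "riemann_zeta (real s) = (\<Sum>n. 1 / real (Suc n) ^ s)"
    by (simp add: riemann_zeta_def powr_realpow del: of_nat_Suc)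
  ultimately show ?thesis by (metis infsumI)
qed

lemma riemann_zeta_ge_1:
  assumes "s \<ge> 2"
  shows "riemann_zeta (real s) \<ge> 1"
proof -
  have "infsum (\<lambda>n. 1 / real n ^ s) {1} \<le> infsum (\<lambda>n. 1 / real n ^ s) {1..}"
    using summable_on_inverse_power[OF assms] by (intro infsum_mono2) auto
  thus ?thesis by (simp add: riemann_zeta_conv_infsum[OF assms])
qed

lemma abs_summable_moebius_power:
  assumes "s \<ge> 2"
  shows "(\<lambda>d. moebius_mu d / real d ^ s) abs_summable_on {1..}"
  using summable_on_inverse_power[OF assms]
  by (rule summable_on_comparison_test) (auto simp: abs_divide abs_moebius_le intro!: divide_right_mono)

text \<open>In the product of the Moebius series with the zeta series, the terms with
  \<open>d * m = n\<close> are collected. Their coefficient is the divisor sum of the Moebius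
  function, so only \<open>n = 1\<close> survives.\<close>

lemma infsum_moebius_power:
  assumes s: "s \<ge> 2"
  shows "infsum (\<lambda>d. moebius_mu d / real d ^ s) {1..} = 1 / riemann_zeta (real s)"
proof -
  define f where "f d = moebius_mu d / real d ^ s" for d
  define g where "g m = 1 / real m ^ s" for m :: nat
  have g: "g summable_on {1..}" unfolding g_def by (rule summable_on_inverse_power[OF s])
  have f: "f abs_summable_on {1..}" unfolding f_def by (rule abs_summable_moebius_power[OF s])
  \<comment> \<open>Absolute summability over pairs licenses the regrouping below.\<close>
  have "(\<lambda>(d, m). f d * g m) abs_summable_on {1..} \<times> {1..}"
    unfolding abs_summable_on_Sigma_iff
  proof (intro conjI ballI)
    fix d :: nat
    show "(\<lambda>m. norm (case (d, m) of (d, m) \<Rightarrow> f d * g m)) summable_on {1..}"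
      using summable_on_cmult_right[OF g, of "\<bar>f d\<bar>"] by (simp add: abs_mult g_def)
  next
    have sm: "(\<lambda>d. norm (f d) * infsum g {1..}) summable_on {1..}"
      using f by (rule summable_on_cmult_left)
    have nonneg: "infsum g {1..} \<ge> 0" by (intro infsum_nonneg) (simp add: g_def)
    have "norm (f d * g m) = norm (f d) * g m" for d m by (simp add: abs_mult g_def)
    moreover have "norm (norm (f d) * infsum g {1..}) = norm (f d) * infsum g {1..}" for d
      using nonneg by (simp add: abs_mult)
    ultimately show "(\<lambda>d. norm (infsum (\<lambda>m. norm (case (d, m) of (d, m) \<Rightarrow> f d * g m)) {1..})) summable_on {1..}"
      using sm by (simp only: prod.case infsum_cmult_right')
  qed
  hence prod: "(\<lambda>(d, m). f d * g m) summable_on {1..} \<times> {1..}"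
    by (rule abs_summable_summable)
  define h where "h = (\<lambda>(n, d). moebius_mu d / real n ^ s)"
  \<comment> \<open>Pairs of factors correspond to pairs of a product and one of its
    divisors.\<close>
  have bij: "bij_betw (\<lambda>(d, m). (d * m, d)) ({1..} \<times> {1..}) (Sigma {1..} (\<lambda>n::nat. {d. d dvd n}))"
    by (rule bij_betwI[of _ _ _ "\<lambda>(n, d). (d, n div d)"])
       (auto simp: Suc_le_eq div_greater_zero_iff dvd_imp_le intro: dvd_pos_nat)
  have reindex: "h (case x of (d, m) \<Rightarrow> (d * m, d)) = (case x of (d, m) \<Rightarrow> f d * g m)" for x
    by (simp add: h_def f_def g_def power_mult_distrib split: prod.split)
  have h: "h summable_on Sigma {1..} (\<lambda>n. {d. d dvd n})"
    using prod summable_on_reindex_bij_betw[OF bij, of h] by (simp add: reindex)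
  have "infsum f {1..} * infsum g {1..} = infsum (\<lambda>d. infsum (\<lambda>m. f d * g m) {1..}) {1..}"
    by (simp add: infsum_cmult_left' infsum_cmult_right')
  also have "\<dots> = infsum (\<lambda>(d, m). f d * g m) ({1..} \<times> {1..})"
    using prod by (rule infsum_Sigma'_banach)
  also have "\<dots> = infsum h (Sigma {1..} (\<lambda>n. {d. d dvd n}))"
    using infsum_reindex_bij_betw[OF bij, of h] by (simp add: reindex)
  also have "\<dots> = infsum (\<lambda>n. infsum (\<lambda>d. h (n, d)) {d. d dvd n}) {1..}"
    using infsum_Sigma_banach[OF h] by simp
  also have "\<dots> = infsum (\<lambda>n::nat. if n = 1 then 1 else 0) {1..}"
  proof (rule infsum_cong)
    fix n :: nat assume n: "n \<in> {1..}"
    hence "infsum (\<lambda>d. h (n, d)) {d. d dvd n} = (\<Sum>d | d dvd n. moebius_mu d) / real n ^ s"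
      by (simp add: h_def sum_divide_distrib)
    thus "infsum (\<lambda>d. h (n, d)) {d. d dvd n} = (if n = 1 then 1 else 0)"
      using n sum_moebius_divisors[of n] by simp
  qed
  also have "\<dots> = infsum (\<lambda>n. 1) {1::nat}"
    by (rule infsum_cong_neutral) auto
  also have "\<dots> = (1::real)" by simp
  finally have "infsum f {1..} * riemann_zeta (real s) = 1"
    unfolding riemann_zeta_conv_infsum[OF s] g_def .
  thus ?thesis
    using riemann_zeta_ge_1[OF s] by (simp add: f_def[abs_def] eq_divide_eq)
qed

section \<open>Tails of the Dirichlet series\<close>

lemma sum_inverse_squares_le:
  assumes "0 < D" "D \<le> N"
  shows "(\<Sum>d\<in>{D<..N}. 1 / real d ^ 2) \<le> 1 / real D - 1 / real N"
  using assms(2)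
proof (induction N rule: dec_induct)
  case (step N)
  have "{D<..Suc N} = insert (Suc N) {D<..N}" using step by auto
  \<comment> \<open>Each new term is absorbed by a telescoping difference; this is why the bound
    carries \<open>- 1 / real N\<close>.\<close>
  moreover have "1 / real (Suc N) ^ 2 \<le> 1 / real N - 1 / real (Suc N)"
  proof -
    have N: "real N > 0" using step assms(1) by simp
    have "1 / real (Suc N) ^ 2 \<le> 1 / (real N * real (Suc N))"
      using N by (intro divide_left_mono mult_pos_pos) (auto simp: power2_eq_square mult_right_mono)
    also have "\<dots> = 1 / real N - 1 / real (Suc N)" using N by (simp add: field_simps)
    finally show ?thesis .
  qed
  ultimately show ?case using step.IH by simp
qed simp

text \<open>Comparison with exponent 2. An arbitrary finite \<open>F\<close> covers both the range
  \<open>{D<..<p}\<close> and, through finite partial sums, the infinite tail.\<close>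

lemma sum_power_tail_le:
  assumes D: "0 < D" and s: "s \<ge> 2" and F: "finite F" "F \<subseteq> {D<..}"
  shows "(\<Sum>d\<in>F. 1 / real d ^ s) \<le> 1 / real D"
proof -
  define N where "N = Max (insert D F)"
  have DN: "D \<le> N" using F by (simp add: N_def)
  have "(\<Sum>d\<in>F. 1 / real d ^ s) \<le> (\<Sum>d\<in>F. 1 / real d ^ 2)"
    using F D s by (intro sum_mono divide_left_mono power_increasing) auto
  also have "\<dots> \<le> (\<Sum>d\<in>{D<..N}. 1 / real d ^ 2)"
    using F by (intro sum_mono2) (auto simp: N_def)
  also have "\<dots> \<le> 1 / real D - 1 / real N" by (rule sum_inverse_squares_le[OF D DN])
  finally show ?thesis by (smt (verit) divide_nonneg_nonneg of_nat_0_le_iff)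
qed

lemma moebius_partial_sum_deviation_le:
  assumes D: "0 < D" and s: "s \<ge> 2"
  shows "\<bar>(\<Sum>d=1..D. moebius_mu d / real d ^ s) - 1 / riemann_zeta (real s)\<bar> \<le> 1 / real D"
proof -
  define f where "f d = moebius_mu d / real d ^ s" for d
  have abs: "f abs_summable_on {1..}" unfolding f_def by (rule abs_summable_moebius_power[OF s])
  have sub: "f abs_summable_on {D<..}"
    by (rule summable_on_subset_banach[OF abs]) (use D in auto)
  have "infsum f {1..} = infsum f ({1..D} \<union> {D<..})"
    using D by (intro arg_cong2[where f = infsum]) auto
  also have "\<dots> = infsum f {1..D} + infsum f {D<..}"
    using sub by (intro infsum_Un_disjoint) (auto intro: abs_summable_summable)
  finally have "(\<Sum>d=1..D. f d) - infsum f {1..} = - infsum f {D<..}" by simp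
  hence "\<bar>(\<Sum>d=1..D. f d) - infsum f {1..}\<bar> = norm (infsum f {D<..})" by simp
  also have "\<dots> \<le> infsum (\<lambda>d. norm (f d)) {D<..}"
    by (rule norm_infsum_bound[OF sub])
  also have "\<dots> \<le> 1 / real D"
  proof (rule infsum_le_finite_sums[OF sub])
    fix F assume F: "finite F" "F \<subseteq> {D<..}"
    have "(\<Sum>d\<in>F. norm (f d)) \<le> (\<Sum>d\<in>F. 1 / real d ^ s)"
      by (intro sum_mono) (simp add: f_def abs_moebius_le divide_right_mono)
    also have "\<dots> \<le> 1 / real D" by (rule sum_power_tail_le[OF D s F])
    finally show "(\<Sum>d\<in>F. norm (f d)) \<le> 1 / real D" .
  qed
  also have "infsum f {1..} = 1 / riemann_zeta (real s)"
    unfolding f_def by (rule infsum_moebius_power[OF s])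
  finally show ?thesis by (simp only: f_def)
qed

subsection \<open>Counting power-free primitive roots\<close>

lemma card_multiples_le:
  assumes "c > 0" "P \<subseteq> {1..<p}"
  shows "real (card {n \<in> P. c dvd n}) \<le> real p / real c"
proof -
  have "{n \<in> P. c dvd n} \<subseteq> (*) c ` {1..p div c}"
  proof safe
    fix n assume "n \<in> P" "c dvd n"
    then obtain k where k: "n = c * k" "1 \<le> n" "n \<le> p" using assms(2) by force
    hence "k \<in> {1..p div c}"
      using assms(1) by (auto simp: less_eq_div_iff_mult_less_eq mult.commute intro!: Suc_leI Nat.gr0I)
    thus "n \<in> (*) c ` {1..p div c}" using k by blast
  qed
  hence "card {n \<in> P. c dvd n} \<le> card ((*) c ` {1..p div c})" by (rule card_mono[rotated]) simp
  also have "\<dots> \<le> p div c" using card_image_le[of "{1..p div c}" "(*) c"] by simp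
  finally have "real (card {n \<in> P. c dvd n}) \<le> real (p div c)" by (simp only: of_nat_le_iff)
  also have "\<dots> \<le> real p / real c" by (rule of_nat_div_le_of_nat)
  finally show ?thesis .
qed

text \<open>The character method yields the density \<open>((p - 1) div c) / p\<close>, whereas the
  main term calls for \<open>p / ((p - 1) * c)\<close>. With at most \<open>p - 1\<close> elements
  counted, exchanging them costs a bounded error.\<close>

lemma main_term_rounding:
  fixes k p c :: nat
  assumes "p \<ge> 2" "c \<ge> 1" "k \<le> p - 1"
  shows "\<bar>real k * real ((p - 1) div c) / real p - real k / real (p - 1) * real p / real c\<bar> \<le> 3"
proof -
  define M q x where "M = real ((p - 1) div c)" and "q = real (p - 1)" and "x = 1 / real c"
  have q: "q > 0" "real p = q + 1" using assms(1) by (auto simp: q_def)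
  have x: "0 < x" "x \<le> 1" using assms(2) by (auto simp: x_def)
  have M1: "M \<le> q * x"
    using of_nat_div_le_of_nat[of "p - 1" c, where 'a = real] by (simp add: M_def q_def x_def)
  have M2: "q * x - 1 \<le> M"
  proof -
    have "(p - 1) mod c < c" using assms(2) by simp
    hence "p - 1 \<le> c * ((p - 1) div c) + c"
      using mult_div_mod_eq[of c "p - 1"] by linarith
    hence "real (p - 1) \<le> real (c * ((p - 1) div c) + c)" by (simp only: of_nat_le_iff)
    hence "q \<le> real c * M + real c" by (simp add: q_def M_def)
    thus ?thesis using assms(2) by (simp add: x_def field_simps)
  qed
  \<comment> \<open>The discrepancy per counted element; multiplied by \<open>k \<le> q\<close> it
    must stay below 3.\<close>
  define \<delta> where "\<delta> = (q + 1) * x / q - M / (q + 1)"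
  have "M / (q + 1) \<le> q * x / (q + 1)" using M1 q by (intro divide_right_mono) auto
  also have "\<dots> \<le> (q + 1) * x / q"
    using q x by (intro frac_le mult_right_mono) auto
  finally have nonneg: "0 \<le> \<delta>" by (simp add: \<delta>_def)
  have "q * M \<ge> q * (q * x - 1)" using M2 q by (intro mult_left_mono) auto
  moreover have "q * \<delta> = (q + 1) * x - q * M / (q + 1)"
    using q by (simp add: \<delta>_def right_diff_distrib)
  hence "(q + 1) * (q * \<delta>) = (q + 1) * ((q + 1) * x) - q * M"
    using q by (simp add: right_diff_distrib)
  ultimately have "(q + 1) * (q * \<delta>) \<le> (q + 1) * ((q + 1) * x) - q * (q * x - 1)" by linarith
  also have "\<dots> = (2 * q + 1) * x + q" by (simp add: algebra_simps power2_eq_square)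
  \<comment> \<open>As \<open>x \<le> 1\<close>, the total is at most \<open>3 * q + 1\<close>,
    which explains the constant 3.\<close>
  also have "\<dots> \<le> (2 * q + 1) * 1 + q" using q x by (intro add_right_mono mult_left_mono) auto
  also have "\<dots> \<le> (q + 1) * 3" using q by simp
  finally have "q * \<delta> \<le> 3" by (rule mult_left_le_imp_le) (use q in simp)
  moreover have "real k * \<delta> \<le> q * \<delta>" using assms(3) nonneg by (intro mult_right_mono) (auto simp: q_def)
  moreover have "0 \<le> real k * \<delta>" using nonneg by simp
  moreover have "real k * real ((p - 1) div c) / real p - real k / real (p - 1) * real p / real c = - (real k * \<delta>)"
    unfolding M_def[symmetric] q_def[symmetric] by (simp add: \<delta>_def x_def q(2) right_diff_distrib)
  ultimately show ?thesis by simp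
qed

text \<open>Each \<open>d \<le> D\<close> costs the completion error plus 3 for rounding. One term
  \<open>p / D\<close> is the trivial bound for all \<open>d > D\<close>, the other comes from
  extending the truncated Moebius series to infinity. The cutoff \<open>D\<close> stays
  free.\<close>

lemma N_power_free_deviation_le:
  assumes p: "prime p" "p > 2" and s: "s \<ge> 2" and D: "0 < D" "D < p"
  shows "\<bar>real (N_power_free s p) - 1 / riemann_zeta (real s) * (real (totient (p - 1)) / real (p - 1)) * real p\<bar>
    \<le> real D * (2 * (2 ^ card (prime_factors (p - 1)) * sqrt (real p)) * (1 + ln (real p)) + 3) + 2 * real p / real D"
proof -
  define P where "P = {n \<in> {1..<p}. ord p n = p - 1}"
  define A where "A d = real (card {n \<in> P. d ^ s dvd n})" for d
  define B where "B = 2 ^ card (prime_factors (p - 1)) * sqrt (real p)"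
  \<comment> \<open>The main term without its zeta factor; \<open>\<kappa> / d ^ s\<close>
    approximates \<open>A d\<close>.\<close>
  define \<kappa> where "\<kappa> = real (totient (p - 1)) / real (p - 1) * real p"
  define E where "E = 2 * B * (1 + ln (real p)) + 3"
  have finP: "finite P" and Psub: "P \<subseteq> {1..<p}" by (auto simp: P_def)
  have cardP: "card P = totient (p - 1)" unfolding P_def by (rule card_primitive_roots[OF p(1)])
  have ndvd: "\<not> p dvd t" if "t \<in> {1..<p}" for t using that nat_dvd_not_less[of t p] by auto
  have charsum: "norm (\<Sum>n\<in>P. add_char p (int t * int n)) \<le> B" if "t \<in> {1..<p}" for t
    using norm_primitive_root_sum_le[OF p(1) ndvd[OF that]] by (simp add: P_def B_def)
  have "{n \<in> {0..<p}. primitive_root_mod p n \<and> mu_power_free s n = 1} = {n \<in> P. power_free s n}"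
    using p(2) by (auto simp: P_def primitive_root_mod_def mu_power_free_def Suc_le_eq intro: Nat.gr0I split: if_splits)
  hence "real (N_power_free s p) = real (card {n \<in> P. power_free s n})"
    by (simp add: N_power_free_def)
  also have "\<dots> = (\<Sum>n\<in>P. real (mu_power_free s n))"
    using finP by (simp add: mu_power_free_def if_distrib[of real] sum.If_cases Int_def cong: if_cong)
  \<comment> \<open>Since \<open>d ^ s dvd n\<close> forces \<open>0 < d < p\<close>, one range of
    \<open>d\<close> serves all \<open>n\<close>, and the sums can be swapped.\<close>
  also have "\<dots> = (\<Sum>n\<in>P. \<Sum>d=1..<p. if d ^ s dvd n then moebius_mu d else 0)"
  proof (rule sum.cong[OF refl])
    fix n assume "n \<in> P"
    hence n: "0 < n" "n < p" using Psub by auto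
    have "d \<in> {1..<p}" if d: "d ^ s dvd n" for d
    proof -
      have "d \<noteq> 0" using d n s by (intro notI) (simp add: power_0_left)
      hence "d ^ 1 \<le> d ^ s" using s by (intro power_increasing) auto
      thus ?thesis using dvd_imp_le[OF d n(1)] n \<open>d \<noteq> 0\<close> by simp
    qed
    hence "{d. d ^ s dvd n} = {d \<in> {1..<p}. d ^ s dvd n}" by blast
    hence "real (mu_power_free s n) = (\<Sum>d\<in>{d \<in> {1..<p}. d ^ s dvd n}. moebius_mu d)"
      using sum_moebius_power_dvd[of n s] n s by simp
    also have "\<dots> = (\<Sum>d=1..<p. if d ^ s dvd n then moebius_mu d else 0)"
      by (rule sum.inter_filter) simp
    finally show "real (mu_power_free s n) = (\<Sum>d=1..<p. if d ^ s dvd n then moebius_mu d else 0)" .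
  qed
  also have "\<dots> = (\<Sum>d=1..<p. \<Sum>n\<in>P. if d ^ s dvd n then moebius_mu d else 0)"
    by (rule sum.swap)
  also have "\<dots> = (\<Sum>d=1..<p. moebius_mu d * A d)"
    using finP by (intro sum.cong refl) (simp add: A_def sum.If_cases Int_def)
  also have "{1..<p} = {1..D} \<union> {D<..<p}" using D by auto
  also have "(\<Sum>d\<in>\<dots>. moebius_mu d * A d) = (\<Sum>d=1..D. moebius_mu d * A d) + (\<Sum>d\<in>{D<..<p}. moebius_mu d * A d)"
    by (rule sum.union_disjoint) auto
  finally have N: "real (N_power_free s p)
      = (\<Sum>d=1..D. moebius_mu d * A d) + (\<Sum>d\<in>{D<..<p}. moebius_mu d * A d)" .
  have tail: "\<bar>\<Sum>d\<in>{D<..<p}. moebius_mu d * A d\<bar> \<le> real p / real D"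
  proof -
    have "\<bar>\<Sum>d\<in>{D<..<p}. moebius_mu d * A d\<bar> \<le> (\<Sum>d\<in>{D<..<p}. \<bar>moebius_mu d * A d\<bar>)"
      by (rule sum_abs)
    also have "\<dots> \<le> (\<Sum>d\<in>{D<..<p}. real p * (1 / real d ^ s))"
    proof (rule sum_mono)
      fix d assume "d \<in> {D<..<p}"
      hence "A d \<le> real p / real (d ^ s)"
        unfolding A_def using D by (intro card_multiples_le Psub) auto
      moreover have "\<bar>moebius_mu d * A d\<bar> \<le> 1 * A d"
        unfolding abs_mult by (intro mult_mono abs_moebius_le) (auto simp: A_def)
      ultimately show "\<bar>moebius_mu d * A d\<bar> \<le> real p * (1 / real d ^ s)" by simp
    qed
    also have "\<dots> = real p * (\<Sum>d\<in>{D<..<p}. 1 / real d ^ s)" by (simp add: sum_distrib_left)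
    also have "\<dots> \<le> real p * (1 / real D)"
      using D s by (intro mult_left_mono sum_power_tail_le) auto
    finally show ?thesis by simp
  qed
  have head_term: "\<bar>A d - \<kappa> / real d ^ s\<bar> \<le> E" if d: "d \<in> {1..D}" for d
  proof -
    \<comment> \<open>The condition \<open>D < p\<close> keeps \<open>d ^ s\<close> prime to
      \<open>p\<close>, even where \<open>d ^ s\<close> exceeds \<open>p\<close>.\<close>
    have "\<not> p dvd d" using d D ndvd[of d] by auto
    hence c: "\<not> p dvd d ^ s" using p(1) prime_dvd_power by blast
    have "\<bar>A d - real (card P) * real ((p - 1) div d ^ s) / real p\<bar> \<le> 2 * B * (1 + ln (real p))"
      unfolding A_def by (rule card_multiples_deviation_le[OF p(1) Psub c charsum])
    moreover have "\<bar>real (card P) * real ((p - 1) div d ^ s) / real p - \<kappa> / real d ^ s\<bar> \<le> 3"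
      using main_term_rounding[of p "d ^ s" "card P"] p(2) d
      by (simp add: cardP \<kappa>_def totient_le)
    ultimately show ?thesis unfolding E_def by linarith
  qed
  have head: "\<bar>(\<Sum>d=1..D. moebius_mu d * A d) - \<kappa> * (\<Sum>d=1..D. moebius_mu d / real d ^ s)\<bar> \<le> real D * E"
  proof -
    have "(\<Sum>d=1..D. moebius_mu d * A d) - \<kappa> * (\<Sum>d=1..D. moebius_mu d / real d ^ s)
        = (\<Sum>d=1..D. moebius_mu d * (A d - \<kappa> / real d ^ s))"
      by (simp add: sum_distrib_left sum_subtractf right_diff_distrib mult.commute)
    also have "\<bar>\<dots>\<bar> \<le> (\<Sum>d=1..D. \<bar>moebius_mu d * (A d - \<kappa> / real d ^ s)\<bar>)" by (rule sum_abs)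
    also have "\<dots> \<le> (\<Sum>d=1..D. 1 * E)"
      unfolding abs_mult by (intro sum_mono mult_mono abs_moebius_le head_term) auto
    finally show ?thesis by simp
  qed
  have \<kappa>: "0 \<le> \<kappa>" "\<kappa> \<le> real p"
  proof -
    have "real (totient (p - 1)) / real (p - 1) \<le> 1"
      using p(2) totient_le[of "p - 1"] by (simp add: divide_le_eq)
    hence "\<kappa> \<le> 1 * real p" unfolding \<kappa>_def by (intro mult_right_mono) auto
    thus "\<kappa> \<le> real p" by simp
  qed (simp add: \<kappa>_def)
  have "\<bar>\<kappa> * (\<Sum>d=1..D. moebius_mu d / real d ^ s) - \<kappa> * (1 / riemann_zeta (real s))\<bar>
      = \<kappa> * \<bar>(\<Sum>d=1..D. moebius_mu d / real d ^ s) - 1 / riemann_zeta (real s)\<bar>"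
    by (simp only: abs_mult abs_of_nonneg[OF \<kappa>(1)] flip: right_diff_distrib)
  also have "\<dots> \<le> real p * (1 / real D)"
    using \<kappa> by (intro mult_mono moebius_partial_sum_deviation_le[OF D(1) s]) auto
  finally have "\<bar>\<kappa> * (\<Sum>d=1..D. moebius_mu d / real d ^ s) - \<kappa> * (1 / riemann_zeta (real s))\<bar> \<le> real p / real D"
    by simp
  hence "\<bar>real (N_power_free s p) - \<kappa> * (1 / riemann_zeta (real s))\<bar> \<le> real D * E + 2 * (real p / real D)"
    using head tail N by linarith
  thus ?thesis by (simp add: \<kappa>_def E_def B_def mult_ac)
qed

text \<open>With \<open>D\<close> about \<open>p powr (1 / 4)\<close>, and with both
  \<open>2 ^ \<omega>\<close> and the logarithm bounded by multiples of
  \<open>p powr (1 / 16)\<close>, the small \<open>d\<close> contribute exponent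
  \<open>1 / 4 + 1 / 2 + 1 / 16 + 1 / 16 = 7 / 8\<close>, and the terms \<open>p / D\<close> only
  \<open>3 / 4\<close>.\<close>

lemma N_power_free_asymptotic:
  assumes s: "s \<ge> 2"
  obtains C :: real where "C > 0"
    "\<And>p. prime p \<Longrightarrow> p \<ge> 16 \<Longrightarrow>
      \<bar>real (N_power_free s p) - 1 / riemann_zeta (real s) * (real (totient (p - 1)) / real (p - 1)) * real p\<bar>
        \<le> C * real p powr (7 / 8)"
proof -
  obtain C :: real where C: "C > 0"
    "\<And>n. n > 0 \<Longrightarrow> 2 ^ card (prime_factors n) \<le> C * real n powr (1 / 16)"
    using two_power_omega_bound[of 16] by auto
  show thesis
  proof
    \<comment> \<open>Here \<open>68 * C + 6 = 2 * (34 * C + 3)\<close>, where the 2 pays for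
      rounding \<open>D\<close> up; the remaining 2 comes from \<open>2 * p / D\<close>.\<close>
    show "68 * C + 8 > 0" using C(1) by simp
    fix p :: nat assume p: "prime p" "p \<ge> 16"
    define x where "x = real p"
    have x: "x \<ge> 16" using p(2) by (simp add: x_def)
    have pow: "x powr a \<ge> 1" if "a \<ge> 0" for a using x that by (intro ge_one_powr_ge_zero) auto
    define D where "D = nat \<lceil>x powr (1 / 4)\<rceil>"
    have D1: "x powr (1 / 4) \<le> real D" unfolding D_def by linarith
    have D2: "real D \<le> 2 * x powr (1 / 4)" unfolding D_def using pow[of "1 / 4"] by linarith
    \<comment> \<open>The threshold 16 enters here: it gives \<open>2 \<le> x powr (1 / 4)\<close>,
      which leads to \<open>D < p\<close>.\<close>
    have "2 * x powr (1 / 4) < x"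
    proof -
      have "(2::real) = 16 powr (1 / 4)"
        using powr_powr[of "2::real" 4 "1 / 4"] by simp
      also have "\<dots> \<le> x powr (1 / 4)" using x by (intro powr_mono2) auto
      finally have "2 * x powr (1 / 4) \<le> x powr (1 / 4) * x powr (1 / 4)"
        by (rule mult_right_mono) simp
      also have "\<dots> = x powr (1 / 2)" by (simp flip: powr_add)
      also have "\<dots> < x powr 1" using x by (intro powr_less_mono) auto
      finally show ?thesis using x by simp
    qed
    hence "real D < real p" using D2 by (simp add: x_def)
    hence D3: "D < p" by simp
    have D0: "0 < D" using D1 pow[of "1 / 4"] by (cases "D = 0") auto
    have "real (p - 1) powr (1 / 16) \<le> x powr (1 / 16)" by (intro powr_mono2) (auto simp: x_def)
    hence "C * real (p - 1) powr (1 / 16) \<le> C * x powr (1 / 16)"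
      using C(1) by (intro mult_left_mono) auto
    hence omega: "2 ^ card (prime_factors (p - 1)) \<le> C * x powr (1 / 16)"
      using C(2)[of "p - 1"] p(2) by linarith
    \<comment> \<open>The factor 17 below is 16 from this bound plus 1 for the summand 1.\<close>
    have "ln x \<le> x powr (1 / 16) / (1 / 16)" using x by (intro ln_powr_bound) auto
    hence ln: "1 + ln x \<le> 17 * x powr (1 / 16)" using pow[of "1 / 16"] by simp
    have "2 * (2 ^ card (prime_factors (p - 1)) * sqrt x) * (1 + ln x)
        \<le> 2 * ((C * x powr (1 / 16)) * x powr (1 / 2)) * (17 * x powr (1 / 16))"
      using x omega ln C(1) by (intro mult_mono) (auto simp: powr_half_sqrt)
    also have "\<dots> = 34 * C * x powr (1 / 16 + 1 / 2 + 1 / 16)"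
      unfolding powr_add by simp
    also have "\<dots> = 34 * C * x powr (5 / 8)" by simp
    finally have "2 * (2 ^ card (prime_factors (p - 1)) * sqrt x) * (1 + ln x) + 3 \<le> (34 * C + 3) * x powr (5 / 8)"
      using pow[of "5 / 8"] unfolding distrib_right[of "34 * C"] by linarith
    hence "real D * (2 * (2 ^ card (prime_factors (p - 1)) * sqrt x) * (1 + ln x) + 3)
        \<le> 2 * x powr (1 / 4) * ((34 * C + 3) * x powr (5 / 8))"
      using D2 x by (intro mult_mono) auto
    also have "\<dots> = (68 * C + 6) * x powr (1 / 4 + 5 / 8)"
      unfolding powr_add by (simp add: algebra_simps)
    finally have 1: "real D * (2 * (2 ^ card (prime_factors (p - 1)) * sqrt x) * (1 + ln x) + 3)
        \<le> (68 * C + 6) * x powr (7 / 8)" by simp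
    have "2 * x / real D \<le> 2 * x / x powr (1 / 4)"
      using D1 x D0 by (intro divide_left_mono mult_pos_pos) auto
    also have "\<dots> = 2 * x powr (1 - 1 / 4)" using x powr_diff[of x 1 "1 / 4"] by simp
    also have "\<dots> \<le> 2 * x powr (7 / 8)" using x by (intro mult_left_mono powr_mono) auto
    finally have 2: "2 * x / real D \<le> 2 * x powr (7 / 8)" .
    have "p > 2" using p(2) by simp
    note N_power_free_deviation_le[OF p(1) this s D0 D3]
    also note add_mono[OF 1 2, unfolded x_def]
    also have "(68 * C + 6) * real p powr (7 / 8) + 2 * real p powr (7 / 8) = (68 * C + 8) * real p powr (7 / 8)"
      by (simp add: algebra_simps)
    finally show "\<bar>real (N_power_free s p) - 1 / riemann_zeta (real s) * (real (totient (p - 1)) / real (p - 1)) * real p\<bar>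
        \<le> (68 * C + 8) * real p powr (7 / 8)" .
  qed
qed

section \<open>Asymptotics and existence along the primes\<close>

lemma eventually_primes_at_top:
  "eventually P primes_at_top \<longleftrightarrow> (\<forall>\<^sub>F p in at_top. prime p \<longrightarrow> P p)"
  by (simp add: primes_at_top_def eventually_inf_principal)

text \<open>"Arbitrarily small" is read as every \<open>\<epsilon>\<close> below a threshold;
  \<open>1 / 8\<close> serves, since then \<open>1 - \<epsilon>\<close> exceeds the proved exponent
  \<open>7 / 8\<close>. Existence follows because the main term is at least a constant times
  \<open>p powr (15 / 16)\<close>.\<close>

theorem theorem1p4:
  fixes s :: nat
  assumes "s \<ge> 2"
  shows "(\<forall>\<^sub>F p in primes_at_top. \<exists>n\<in>{0..<p}. primitive_root_mod p n \<and> power_free s n) \<and>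
    (\<exists>\<epsilon>\<^sub>0>0. \<forall>\<epsilon>::real. 0 < \<epsilon> \<and> \<epsilon> < \<epsilon>\<^sub>0 \<longrightarrow>
      (\<lambda>p. real (N_power_free s p)
            - 1 / riemann_zeta (real s) * (real (totient (p - 1)) / real (p - 1)) * real p)
        \<in> O[primes_at_top](\<lambda>p. real p powr (1 - \<epsilon>)))"
proof -
  define main where "main p = 1 / riemann_zeta (real s) * (real (totient (p - 1)) / real (p - 1)) * real p" for p
  obtain C :: real where C: "C > 0"
    "\<And>p. prime p \<Longrightarrow> p \<ge> 16 \<Longrightarrow> \<bar>real (N_power_free s p) - main p\<bar> \<le> C * real p powr (7 / 8)"
    unfolding main_def using N_power_free_asymptotic[OF assms] by blast
  obtain C' :: real where C': "C' > 0"
    "\<And>n. n > 0 \<Longrightarrow> 2 ^ card (prime_factors n) \<le> C' * real n powr (1 / 16)"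
    using two_power_omega_bound[of 16] by auto
  \<comment> \<open>The factor \<open>1 / C'\<close> comes from the lower bound
    \<open>1 / 2 ^ \<omega>\<close> for the totient ratio, which loses only
    \<open>p powr (1 / 16)\<close>.\<close>
  define c where "c = 1 / (riemann_zeta (real s) * C')"
  have c: "c > 0" using C'(1) riemann_zeta_ge_1[OF assms] by (simp add: c_def)
  have main_ge: "c * real p powr (15 / 16) \<le> main p" if p: "p \<ge> 16" for p
  proof -
    have "2 ^ card (prime_factors (p - 1)) \<le> C' * real (p - 1) powr (1 / 16)"
      using p by (intro C'(2)) auto
    also have "\<dots> \<le> C' * real p powr (1 / 16)"
      using C'(1) by (intro mult_left_mono powr_mono2) auto
    finally have "1 / (C' * real p powr (1 / 16)) \<le> 1 / 2 ^ card (prime_factors (p - 1))"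
      using C'(1) p by (intro divide_left_mono mult_pos_pos) auto
    also have "\<dots> \<le> real (totient (p - 1)) / real (p - 1)"
      using p by (intro totient_ratio_ge) auto
    finally have "1 / riemann_zeta (real s) * (1 / (C' * real p powr (1 / 16))) * real p \<le> main p"
      unfolding main_def using riemann_zeta_ge_1[OF assms] by (intro mult_right_mono mult_left_mono) auto
    moreover have "real p powr (15 / 16) = real p / real p powr (1 / 16)"
      using p powr_diff[of "real p" 1 "1 / 16"] by simp
    ultimately show ?thesis by (simp add: c_def)
  qed
  have "\<forall>\<^sub>F p in at_top. C * real p powr (7 / 8) < c * real p powr (15 / 16)"
    using c C(1) by real_asymp
  hence "\<forall>\<^sub>F p in primes_at_top. \<exists>n\<in>{0..<p}. primitive_root_mod p n \<and> power_free s n"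
    unfolding eventually_primes_at_top using eventually_ge_at_top[of "16::nat"]
  proof eventually_elim
    case (elim p)
    show ?case
    proof
      assume "prime p"
      hence "real (N_power_free s p) > 0"
        using C(2)[of p] main_ge[of p] elim by linarith
      hence "{n \<in> {0..<p}. primitive_root_mod p n \<and> mu_power_free s n = 1} \<noteq> {}"
        unfolding N_power_free_def by (auto simp: card_gt_0_iff)
      thus "\<exists>n\<in>{0..<p}. primitive_root_mod p n \<and> power_free s n"
        by (auto simp: mu_power_free_def split: if_splits)
    qed
  qed
  moreover have "(\<lambda>p. real (N_power_free s p) - main p) \<in> O[primes_at_top](\<lambda>p. real p powr (1 - \<epsilon>))"
    if \<epsilon>: "0 < \<epsilon> \<and> \<epsilon> < 1 / 8" for \<epsilon> :: real
  \<comment> \<open>The same \<open>C\<close> works for every admissible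
    \<open>\<epsilon>\<close>.\<close>
  proof (rule bigoI[of _ C])
    show "\<forall>\<^sub>F p in primes_at_top. norm (real (N_power_free s p) - main p) \<le> C * norm (real p powr (1 - \<epsilon>))"
      unfolding eventually_primes_at_top using eventually_ge_at_top[of "16::nat"]
    proof eventually_elim
      case (elim p)
      have "C * real p powr (7 / 8) \<le> C * real p powr (1 - \<epsilon>)"
        using elim \<epsilon> C(1) by (intro mult_left_mono powr_mono) auto
      thus ?case using C(2)[of p] elim by auto
    qed
  qed
  ultimately show ?thesis
    unfolding main_def by (intro conjI exI[of _ "1 / 8"]) auto
qed

end
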